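(* Let $d\ge2$ be an integer. Then $$\lim_{r\to\infty}U^{\langle d\rangle}(r)\,r=\frac{1}{(d-1)\pi},$$ and consequently $$\lim_{r\to\infty}\frac{W^{\langle d\rangle}(r)}{r^{1-d}}=\frac{2}{\Gamma(d)\,\pi\,\operatorname{vol}(S^{d-1})}.$$
   Context: Let $U:[0,\infty)\to\mathbb{R}$, $U(r)=\tfrac12$ for $r\le 1$ and $U(r)=\tfrac12-\tfrac1\pi\operatorname{arcsec}(r)$ for $r>1$. For integer $d\ge2$ define $U^{\langle d\rangle}:[0,\infty)\to\mathbb{R}$ by $$U^{\langle d\rangle}(r)=U(r)-\int_1^\infty U(tr)(d-2)t^{1-d}\,dt,$$ which equals $\frac{r^{d-2}}{\pi}\int_1^\infty\frac{t^{1-d}}{\sqrt{t^2-1}}dt$ for $r\le1$ and $\frac1\pi\int_1^\infty\frac{t^{1-d}}{\sqrt{r^2t^2-1}}dt$ for $r>1$. For $r>0$ define $$W^{\langle d\rangle}(r)=\frac{2}{\Gamma(d-1)\operatorname{vol}(S^{d-1})}\,\frac{1}{r^d}\int_0^r U^{\langle d\rangle}(t)\,t\,dt,$$ where $\operatorname{vol}(S^{d-1})=2\pi^{d/2}/\Gamma(d/2)$ is the surface measure of the unit sphere in $\mathbb{R}^d$. *)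

theory Defs
  imports "HOL-Analysis.Analysis"
begin

text \<open>
  The functions below live on the half-line of nonnegative reals (\<open>W\<close> on the positive reals);
  the values of their total extensions at other arguments carry no meaning and are never used.
\<close>

text \<open>Meant for \<open>\<bar>x\<bar> \<ge> 1\<close>.\<close>

definition arcsec :: "real \<Rightarrow> real" where
  "arcsec x = arccos (1 / x)"

definition U :: "real \<Rightarrow> real" where
  "U r = (if r \<le> 1 then 1 / 2 else 1 / 2 - (1 / pi) * arcsec r)"

text \<open>
  The integral is a Lebesgue integral over \<open>[1, \<infinity>)\<close>. For \<open>d \<ge> 2\<close> and \<open>r \<ge> 0\<close> it exists:
  the integrand vanishes if \<open>d = 2\<close>, and otherwise it is dominated by a multiple of
  \<open>t powi (1 - int d)\<close> because \<open>U\<close> is bounded on the half-line.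
\<close>

definition U_dim :: "nat \<Rightarrow> real \<Rightarrow> real" where
  "U_dim d r = U r - (LBINT t:{1..}. U (t * r) * (real d - 2) * t powi (1 - int d))"

text \<open>Surface measure of the unit sphere \<open>S\<^sup>d\<^sup>-\<^sup>1\<close>; note that \<open>d\<close> is the dimension of the ambient space.\<close>

definition vol_sphere :: "nat \<Rightarrow> real" where
  "vol_sphere d = 2 * pi powr (real d / 2) / Gamma (real d / 2)"

definition W_dim :: "nat \<Rightarrow> real \<Rightarrow> real" where
  "W_dim d r = 2 / (Gamma (real d - 1) * vol_sphere d) * (1 / r ^ d)
     * (LBINT t:{0..r}. U_dim d t * t)"

end

theory Submission
  imports Defs
begin

text \<open>
  Since \<open>arccos y = \<pi>/2 - arcsin y\<close> and \<open>arcsin y / y \<rightarrow> 1\<close> as \<open>y \<rightarrow> 0\<close>, the function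
  \<open>g r = U r * r\<close> is bounded on the half-line and tends to \<open>1/\<pi>\<close>. As
  \<open>U_dim d r * r = g r - (d - 2) * \<integral>\<^sub>1\<^sup>\<infinity> g (t * r) * t\<^sup>-\<^sup>d dt\<close>, dominated convergence gives the limit
  \<open>(1 - (d - 2) / (d - 1)) / \<pi>\<close>. The second limit is the continuous Cesaro theorem: up to constants,
  \<open>W_dim d r / r\<^sup>1\<^sup>-\<^sup>d\<close> is the mean over \<open>[0, r]\<close> of the bounded convergent function
  \<open>U_dim d t * t\<close>.
\<close>

text \<open>The gauge integral of \<open>1 / x ^ n\<close> is known. The integrand is nonnegative on
  \<open>{a..}\<close>, so it is absolutely integrable there, and Borel measurability carries this
  from the completed measure to \<open>lborel\<close>.\<close>

lemma set_integrable_inverse_power_to_inf: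
  fixes a :: real
  assumes "a > 0" "n > 1"
  shows "set_integrable lborel {a..} (\<lambda>x. 1 / x ^ n)"
    and "(LBINT x:{a..}. 1 / x ^ n) = 1 / (real (n - 1) * a ^ (n - 1))"
proof -
  have hi: "((\<lambda>x. 1 / x ^ n) has_integral 1 / (real (n - 1) * a ^ (n - 1))) {a..}"
    using has_integral_inverse_power_to_inf[OF assms(2,1)] .
  have "(\<lambda>x. 1 / x ^ n) absolutely_integrable_on {a..}"
    by (rule nonnegative_absolutely_integrable_1) (use hi assms in auto)
  then show i: "set_integrable lborel {a..} (\<lambda>x. 1 / x ^ n)"
    unfolding set_integrable_def by (subst (asm) integrable_completion) auto
  show "(LBINT x:{a..}. 1 / x ^ n) = 1 / (real (n - 1) * a ^ (n - 1))"
    using set_borel_integral_eq_integral(2)[OF i] hi by (simp add: integral_unique)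
qed

text \<open>Dominated convergence with majorant \<open>C / t ^ n\<close>: for each fixed
  \<open>t \<ge> 1\<close> the argument \<open>t * r\<close> tends to infinity with
  \<open>r\<close>. The weight \<open>1 / t ^ n\<close> has total mass \<open>1 / (n - 1)\<close> on
  \<open>{1..}\<close>, which gives the factor in the bound and in the limit. Measurability and the
  bound are recorded because the mean of a function built from \<open>H\<close> is taken
  later.\<close>

lemma tail_average:
  fixes g :: "real \<Rightarrow> real"
  assumes g [measurable]: "g \<in> borel_measurable borel"
    and bound: "\<forall>r\<ge>0. \<bar>g r\<bar> \<le> C"
    and lim: "(g \<longlongrightarrow> L) at_top"
    and n: "n > 1"
  defines "H \<equiv> \<lambda>r. LBINT t:{1..}. g (t * r) / t ^ n"
  shows tail_average_measurable: "H \<in> borel_measurable borel"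
    and tail_average_bound: "\<And>r. r \<ge> 0 \<Longrightarrow> \<bar>H r\<bar> \<le> C / (real n - 1)"
    and tail_average_tendsto: "(H \<longlongrightarrow> L / (real n - 1)) at_top"
proof -
  show "H \<in> borel_measurable borel"
    unfolding H_def set_lebesgue_integral_def by measurable
  note int = set_integrable_inverse_power_to_inf[of 1 n, OF _ n, simplified]
  have w: "integrable lborel (\<lambda>t. indicator {1..} t *\<^sub>R (C * (1 / t ^ n)))"
    using set_integrable_mult_right[of C, OF int(1)] unfolding set_integrable_def by simp
  \<comment> \<open>The constant is left free: \<open>C\<close> gives the bound and \<open>L\<close>
    gives the limit.\<close>
  have wI: "(\<integral>t. indicator {1..} t *\<^sub>R (c * (1 / t ^ n)) \<partial>lborel) = c / (real n - 1)" for c :: real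
    using int(2) n set_integral_mult_right[of lborel "{1..}" c "\<lambda>t. 1 / t ^ n"]
    by (simp add: set_lebesgue_integral_def of_nat_diff)
  have dom: "norm (indicator {1..} t *\<^sub>R (g (t * r) / t ^ n))
      \<le> indicator {1..} t *\<^sub>R (C * (1 / t ^ n))" if "r \<ge> 0" for r t :: real
    using bound[rule_format, of "t * r"] that by (auto simp: indicator_def divide_right_mono)
  show "\<bar>H r\<bar> \<le> C / (real n - 1)" if "r \<ge> 0" for r
  proof -
    have i: "integrable lborel (\<lambda>t. indicator {1..} t *\<^sub>R (g (t * r) / t ^ n))"
      by (rule Bochner_Integration.integrable_bound[OF w _ AE_I2], measurable)
        (use dom[OF that] in \<open>auto simp only: real_norm_def intro: order_trans[OF _ abs_ge_self]\<close>)
    show ?thesis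
      unfolding H_def set_lebesgue_integral_def
      using Bochner_Integration.integral_norm_bound_integral[OF i w dom[OF that]] wI[of C] by simp
  qed
  have "((\<lambda>r. \<integral>t. indicator {1..} t *\<^sub>R (g (t * r) / t ^ n) \<partial>lborel)
      \<longlongrightarrow> (\<integral>t. indicator {1..} t *\<^sub>R (L * (1 / t ^ n)) \<partial>lborel)) at_top"
  proof (rule integral_dominated_convergence_at_top[OF _ _ w])
    show "\<forall>\<^sub>F r in at_top. AE t in lborel. norm (indicator {1..} t *\<^sub>R (g (t * r) / t ^ n))
        \<le> indicator {1..} t *\<^sub>R (C * (1 / t ^ n))"
      using eventually_ge_at_top[of 0] by eventually_elim (use dom in auto)
    show "AE t in lborel. ((\<lambda>r. indicator {1..} t *\<^sub>R (g (t * r) / t ^ n))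
        \<longlongrightarrow> indicator {1..} t *\<^sub>R (L * (1 / t ^ n))) at_top"
    proof (rule AE_I2)
      fix t :: real
      have "((\<lambda>r. g (t * r) / t ^ n) \<longlongrightarrow> L / t ^ n) at_top" if "t \<ge> 1"
      proof (intro tendsto_divide tendsto_const filterlim_compose[OF lim])
        show "filterlim (\<lambda>r. t * r) at_top at_top"
          using that by (intro filterlim_tendsto_pos_mult_at_top[OF tendsto_const] filterlim_ident) auto
      qed (use that in auto)
      then show "((\<lambda>r. indicator {1..} t *\<^sub>R (g (t * r) / t ^ n))
          \<longlongrightarrow> indicator {1..} t *\<^sub>R (L * (1 / t ^ n))) at_top"
        by (cases "t \<ge> 1") auto
    qed
  qed measurable
  then show "(H \<longlongrightarrow> L / (real n - 1)) at_top"
    unfolding H_def set_lebesgue_integral_def wI .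
qed

text \<open>The substitution \<open>t = r * s\<close> turns the mean into an integral over the fixed
  interval \<open>{0..1}\<close>. There \<open>f (r * s)\<close> tends to \<open>L\<close> for every
  \<open>s > 0\<close>, and the constant \<open>C\<close> is a majorant.\<close>

lemma integral_mean_tendsto:
  fixes f :: "real \<Rightarrow> real"
  assumes f [measurable]: "f \<in> borel_measurable borel"
    and bound: "\<And>r. r \<ge> 0 \<Longrightarrow> \<bar>f r\<bar> \<le> C"
    and lim: "(f \<longlongrightarrow> L) at_top"
  shows "((\<lambda>r. (LBINT t:{0..r}. f t) / r) \<longlongrightarrow> L) at_top"
proof -
  have rescale: "(LBINT t:{0..r}. f t) / r = (\<integral>s. indicator {0..1} s * f (r * s) \<partial>lborel)"
    if "r > 0" for r
  proof -
    have "indicator {0..r} (r * s) = (indicator {0..1} s :: real)" for s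
      using that by (auto simp: indicator_def zero_le_mult_iff)
    then show ?thesis
      unfolding set_lebesgue_integral_def
      using that by (subst lborel_integral_real_affine[of r _ 0]) auto
  qed
  have "((\<lambda>r. \<integral>s. indicator {0..1} s * f (r * s) \<partial>lborel)
      \<longlongrightarrow> (\<integral>s. indicator {0..1::real} s * L \<partial>lborel)) at_top"
  proof (rule integral_dominated_convergence_at_top[where w = "\<lambda>s. indicator {0..1} s * C"])
    show "integrable lborel (\<lambda>s. indicator {0..1::real} s * C)"
      by (intro integrable_mult_left integrable_real_indicator) auto
    show "\<forall>\<^sub>F r in at_top. AE s in lborel. norm (indicator {0..1} s * f (r * s))
        \<le> indicator {0..1} s * C"
      using eventually_ge_at_top[of 0]
      by eventually_elim (auto simp: indicator_def bound)
    show "AE s in lborel. ((\<lambda>r. indicator {0..1} s * f (r * s))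
        \<longlongrightarrow> indicator {0..1} s * L) at_top"
      \<comment> \<open>At \<open>s = 0\<close> the integrand is \<open>f 0\<close> for every
        \<open>r\<close> and need not converge to \<open>L\<close>, so this null set is discarded.
        For \<open>s < 0\<close> the indicator vanishes.\<close>
      using AE_lborel_singleton[of 0]
    proof eventually_elim
      fix s :: real
      assume "s \<noteq> 0"
      have "((\<lambda>r. f (r * s)) \<longlongrightarrow> L) at_top" if "s > 0"
        using that
        by (intro filterlim_compose[OF lim] filterlim_at_top_mult_tendsto_pos[OF tendsto_const]
            filterlim_ident)
      then show "((\<lambda>r. indicator {0..1} s * f (r * s)) \<longlongrightarrow> indicator {0..1} s * L) at_top"
        using \<open>s \<noteq> 0\<close> by (cases "s > 0") (auto intro: tendsto_mult)
    qed
  qed measurable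
  then have "((\<lambda>r. \<integral>s. indicator {0..1} s * f (r * s) \<partial>lborel) \<longlongrightarrow> L) at_top"
    by simp
  then show ?thesis
    by (rule Lim_transform_eventually)
      (use eventually_gt_at_top[of 0] in eventually_elim, simp add: rescale)
qed

text \<open>The constant \<open>1 / 2\<close> cancels in this form, so the decay at infinity can be
  read off from \<open>arcsin\<close> near 0.\<close>

lemma U_eq_arcsin:
  assumes "r > 1"
  shows "U r = arcsin (1 / r) / pi"
proof -
  have "0 < 1 / r" "1 / r \<le> 1"
    using assms by auto
  then have "arccos (1 / r) = pi / 2 - arcsin (1 / r)"
    by (intro arccos_arcsin_eq) linarith+
  then show ?thesis
    using assms by (simp add: U_def arcsec_def diff_divide_distrib)
qed

lemma abs_U_le: "\<bar>U r\<bar> \<le> 1 / 2"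
proof (cases "r > 1")
  case True
  have "0 < 1 / r" "1 / r \<le> 1"
    using True by auto
  then have "0 \<le> arcsin (1 / r)" "arcsin (1 / r) \<le> pi / 2"
    by (intro arcsin_nonneg arcsin_ubound; simp del: le_divide_eq_1 divide_le_eq_1; linarith)+
  then have "0 \<le> arcsin (1 / r) / pi" "arcsin (1 / r) / pi \<le> 1 / 2"
    by (simp_all add: pos_divide_le_eq)
  then show ?thesis
    unfolding U_eq_arcsin[OF True] by linarith
qed (simp add: U_def)

lemma U_measurable [measurable]: "U \<in> borel_measurable borel"
proof -
  \<comment> \<open>The case split is phrased as membership in a Borel set, to fit the rule for
    functions continuous on such a set and on its complement.\<close>
  have "(\<lambda>r. if r \<in> {..1} then 1 / 2 else 1 / 2 - (1 / pi) * arcsec r) \<in> borel_measurable borel"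
    unfolding arcsec_def
    by (intro borel_measurable_continuous_on_if continuous_intros) (auto simp: field_simps)
  then show ?thesis
    by (simp add: U_def[abs_def])
qed

text \<open>With \<open>y = 1 / r\<close> the product is \<open>arcsin y / y / pi\<close> for
  \<open>r > 1\<close>, and the difference quotient tends to the derivative of \<open>arcsin\<close>
  at 0, which is 1.\<close>

lemma U_times_tendsto: "((\<lambda>r. U r * r) \<longlongrightarrow> 1 / pi) at_top"
proof -
  have "(arcsin has_real_derivative 1) (at 0)"
    using DERIV_arcsin[of 0] by simp
  then have "((\<lambda>y. arcsin y / y) \<longlongrightarrow> 1) (at 0)"
    by (simp add: has_field_derivative_iff)
  moreover have "filterlim (\<lambda>r::real. 1 / r) (at 0) at_top"
    using filterlim_inverse_at_right_top
    by (auto simp: inverse_eq_divide intro: filterlim_mono[OF _ at_le])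
  ultimately have "((\<lambda>r. arcsin (1 / r) / (1 / r)) \<longlongrightarrow> 1) at_top"
    by (rule filterlim_compose)
  then have "((\<lambda>r. arcsin (1 / r) / (1 / r) / pi) \<longlongrightarrow> 1 / pi) at_top"
    by (intro tendsto_intros) auto
  then show ?thesis
    by (rule Lim_transform_eventually)
      (use eventually_gt_at_top[of 1] in eventually_elim, simp add: U_eq_arcsin)
qed

text \<open>The limit controls the product beyond some \<open>R\<close>; on the rest of the
  half-line \<open>\<bar>U r\<bar> \<le> 1 / 2\<close> bounds it by \<open>R / 2\<close>.\<close>

lemma U_times_bounded:
  obtains C where "\<forall>r\<ge>0. \<bar>U r * r\<bar> \<le> C"
proof -
  have "\<forall>\<^sub>F r in at_top. \<bar>U r * r\<bar> < 1 / pi + 1"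
    using tendsto_rabs[OF U_times_tendsto] by (rule order_tendstoD) simp
  then obtain R where R: "\<And>r. r \<ge> R \<Longrightarrow> \<bar>U r * r\<bar> < 1 / pi + 1"
    by (auto simp: eventually_at_top_linorder)
  have "\<bar>U r * r\<bar> \<le> max (1 / pi + 1) (1 / 2 * R)" if "r \<ge> 0" for r
  proof (cases "r \<ge> R")
    case False
    then have "\<bar>U r\<bar> * \<bar>r\<bar> \<le> 1 / 2 * R"
      using that abs_U_le by (intro mult_mono) auto
    then show ?thesis
      by (simp add: abs_mult)
  qed (use R[of r] in auto)
  then show thesis
    using that by blast
qed

text \<open>For \<open>t \<ge> 1\<close> one has \<open>t powi (1 - int d) = t / t ^ d\<close>. The
  factor \<open>t\<close> and the outer \<open>r\<close> together supply \<open>t * r\<close>, so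
  the integral takes the shape treated in \<open>tail_average\<close> with
  \<open>n = d\<close>.\<close>

lemma U_dim_times_eq:
  assumes "d \<ge> 2"
  shows "U_dim d r * r
    = U r * r - (real d - 2) * (LBINT t:{1..}. U (t * r) * (t * r) / t ^ d)"
proof -
  have "(LBINT t:{1..}. U (t * r) * (real d - 2) * t powi (1 - int d)) * r
      = (LBINT t:{1..}. U (t * r) * (real d - 2) * t powi (1 - int d) * r)"
    by simp
  also have "\<dots> = (LBINT t:{1..}. (real d - 2) * (U (t * r) * (t * r) / t ^ d))"
    by (rule set_lebesgue_integral_cong) (auto simp: power_int_diff)
  also have "\<dots> = (real d - 2) * (LBINT t:{1..}. U (t * r) * (t * r) / t ^ d)"
    by (rule set_integral_mult_right)
  finally show ?thesis
    by (simp add: U_dim_def left_diff_distrib)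
qed

theorem corollary3p13:
  fixes d :: nat
  assumes "d \<ge> 2"
  shows "((\<lambda>r. U_dim d r * r) \<longlongrightarrow> 1 / ((real d - 1) * pi)) at_top
    \<and> ((\<lambda>r. W_dim d r / r powi (1 - int d))
         \<longlongrightarrow> 2 / (Gamma (real d) * pi * vol_sphere d)) at_top"
proof
  define H where "H = (\<lambda>r. LBINT t:{1..}. U (t * r) * (t * r) / t ^ d)"
  have eq: "(\<lambda>r. U_dim d r * r) = (\<lambda>r. U r * r - (real d - 2) * H r)"
    unfolding H_def by (intro ext U_dim_times_eq assms)
  obtain C where C: "\<forall>r\<ge>0. \<bar>U r * r\<bar> \<le> C"
    by (rule U_times_bounded)
  have g: "(\<lambda>r. U r * r) \<in> borel_measurable borel"
    by measurable
  have d: "d > 1"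
    using assms by simp
  note tail = tail_average[OF g C U_times_tendsto d, folded H_def]
  have [measurable]: "H \<in> borel_measurable borel"
    by (rule tail(1))
  have meas: "(\<lambda>r. U_dim d r * r) \<in> borel_measurable borel"
    unfolding eq by measurable
  \<comment> \<open>The two summands bound \<open>U r * r\<close> and the tail term;
    \<open>d \<ge> 2\<close> makes \<open>real d - 2\<close> its own absolute value.\<close>
  have bound: "\<bar>U_dim d r * r\<bar> \<le> C + (real d - 2) * (C / (real d - 1))" if "r \<ge> 0" for r
  proof -
    have "\<bar>H r\<bar> \<le> C / (real d - 1)"
      using tail(2)[OF that] by (simp add: H_def)
    then have "\<bar>real d - 2\<bar> * \<bar>H r\<bar> \<le> (real d - 2) * (C / (real d - 1))"
      using assms by (intro mult_mono) auto
    then have "\<bar>(real d - 2) * H r\<bar> \<le> (real d - 2) * (C / (real d - 1))"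
      by (simp only: abs_mult)
    then show ?thesis
      using C[rule_format, OF that] fun_cong[OF eq, of r] by linarith
  qed
  have "((\<lambda>r. U_dim d r * r) \<longlongrightarrow> 1 / pi - (real d - 2) * (1 / pi / (real d - 1))) at_top"
    unfolding eq by (intro tendsto_intros U_times_tendsto tail(3))
  also have "1 / pi - (real d - 2) * (1 / pi / (real d - 1)) = 1 / ((real d - 1) * pi)"
    using assms by (simp add: divide_simps)
  finally show lim: "((\<lambda>r. U_dim d r * r) \<longlongrightarrow> 1 / ((real d - 1) * pi)) at_top" .

  define K where "K = 2 / (Gamma (real d - 1) * vol_sphere d)"
  \<comment> \<open>Away from the poles of \<open>Gamma\<close> the functional equation applies; it
    absorbs the factor \<open>real d - 1\<close> of the first limit into
    \<open>Gamma (real d)\<close>.\<close>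
  have "real d - 1 \<notin> \<int>\<^sub>\<le>\<^sub>0"
  proof
    assume "real d - 1 \<in> \<int>\<^sub>\<le>\<^sub>0"
    then obtain n where "real d - 1 = of_int n" "n \<le> 0"
      by (rule nonpos_Ints_cases)
    then have "real d - 1 \<le> 0"
      by simp
    then show False
      using assms by simp
  qed
  then have "Gamma (real d) = (real d - 1) * Gamma (real d - 1)"
    using Gamma_plus1[of "real d - 1"] by simp
  then have K: "K * (1 / ((real d - 1) * pi)) = 2 / (Gamma (real d) * pi * vol_sphere d)"
    by (simp add: K_def mult_ac)
  have "((\<lambda>r. K * ((LBINT t:{0..r}. U_dim d t * t) / r)) \<longlongrightarrow> K * (1 / ((real d - 1) * pi))) at_top"
    by (intro tendsto_mult tendsto_const integral_mean_tendsto[OF meas bound lim])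
  then have "((\<lambda>r. W_dim d r / r powi (1 - int d)) \<longlongrightarrow> K * (1 / ((real d - 1) * pi))) at_top"
    \<comment> \<open>For \<open>r > 0\<close> the quotient of \<open>1 / r ^ d\<close> by
      \<open>r powi (1 - int d)\<close> is \<open>1 / r\<close>, so both functions agree
      there.\<close>
    by (rule Lim_transform_eventually)
      (use eventually_gt_at_top[of 0] in eventually_elim,
        simp add: W_dim_def K_def power_int_diff)
  then show "((\<lambda>r. W_dim d r / r powi (1 - int d))
      \<longlongrightarrow> 2 / (Gamma (real d) * pi * vol_sphere d)) at_top"
    unfolding K .
qed

end
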